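(* Let $n\ge 1$ and let $\Phi_k(\zeta,\bar\zeta)$, $-n\le k\le n$, be a system of rational functions of the two variables $\zeta,\bar\zeta$. For $f_n(z)=z\sum_{k=0}^n a_kz^k$ with $a_0>0$ and $a_1,\dots,a_n\in\mathbb{C}$, put $f_n^*(z)=\overline{f_n(1/\bar z)}$, $a_{-k}=\bar a_k$ for $1\le k\le n$, define the generalized moments $$\phi_k=\frac{1}{2\pi \mathrm{i}}\int_{\mathbb{T}}\Phi_k(f_n(z),f_n^*(z))\,f_n'(z)\,dz,\qquad -n\le k\le n,$$ and the residue matrix $$v_{kj}=\frac{1}{2\pi \mathrm{i}}\int_{\mathbb{T}}\frac{\partial\Phi_k}{\partial\bar\zeta}(f_n(z),f_n^*(z))\,\frac{dz}{z^{1+j}},\qquad -n\le k,j\le n.$$ Then the Jacobian of the generalized moment map $(a_{-n},\dots,a_0,\dots,a_n)\mapsto(\phi_{-n},\dots,\phi_0,\dots,\phi_n)$ is $$\frac{\partial(\phi_{-n},\dots,\phi_0,\dots,\phi_n)}{\partial(a_{-n},\dots,a_0,\dots,a_n)}=2a_0^{2n+1}\,\det(v_{kj})_{-n\le k,j\le n}\cdot\mathcal{R}(f_n',f_n'^* ).$$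
   Context: $\mathbb{T}$ is the positively oriented unit circle. Rational functions $\Phi_k(\zeta,\bar\zeta)$ are rational in two independent variables $\zeta$ and $\bar\zeta$; $\partial\Phi_k/\partial\bar\zeta$ is the partial derivative in the second variable, and $\Phi_k(f_n,f_n^* )$ means substituting $\zeta=f_n(z)$, $\bar\zeta=f_n^*(z)$. It is understood that the integrals make sense, i.e. the denominators of the $\Phi_k$ do not vanish at $(f_n(z),f_n^*(z))$ for $z\in\mathbb{T}$. The $2n+1$ coefficients $a_{-n},\dots,a_{-1},a_0,a_1,\dots,a_n$ (with $a_{-k}=\bar a_k$, $k\ge1$, and $a_0$ real) are treated as independent variables when differentiating: $\partial/\partial a_k$ and $\partial/\partial a_{-k}=\partial/\partial\bar a_k$ ($k\ge 1$) are Wirtinger derivatives, and $\partial/\partial a_0$ is the ordinary derivative in the real variable $a_0$. Explicitly $f_n^*(z)=a_0z^{-1}+\sum_{k=1}^n a_{-k}z^{-k-1}$. The Jacobian $\partial(\phi_{-n},\dots,\phi_n)/\partial(a_{-n},\dots,a_n)$ is the determinant $\det(\partial\phi_k/\partial a_j)_{-n\le k,j\le n}$, rows and columns ordered from $-n$ to $n$. Put $f_n'(z)=\sum_{k=0}^n b_kz^k$ and $f_n'^*(z)=\overline{f_n'(1/\bar z)}=\sum_{k=0}^n b_{-k}z^{-k}$, so $b_k=(k+1)a_k$ and $b_{-k}=(k+1)\bar a_k$ for $k\geq 0$ (and $b_0=a_0$). $\mathcal{R}$ denotes the meromorphic resultant, defined for meromorphic functions $f,g$ on the Riemann sphere whose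 divisors have no common points by $\mathcal{R}(f,g)=\prod_i g(\xi_i)^{N_i}$, where $\sum_i N_i\cdot\xi_i$ is the divisor of $f$. Here it is given in all cases by the $2n\times 2n$ Sylvester determinant $$\mathcal{R}(f_n',f_n'^* )=\frac{1}{b_0^{2n}}\det\begin{pmatrix} b_0 & b_{-1} & \cdots & b_{-n} & & \\ & \ddots & & & \ddots & \\ & & b_0 & b_{-1} & \cdots & b_{-n}\\ b_n & b_{n-1} & \cdots & b_0 & & \\ & \ddots & & & \ddots & \\ & & b_n & b_{n-1} & \cdots & b_0\end{pmatrix},$$ in which the first $n$ rows are the successive right shifts of $(b_0,b_{-1},\dots,b_{-n},0,\dots,0)$ and the last $n$ rows are the successive right shifts of $(b_n,b_{n-1},\dots,b_0,0,\dots,0)$.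
   Formalization: The right-hand side carries an additional factor (-1)^n; with rows and columns ordered from -n to n the printed formula has the wrong sign for odd n (e.g. n=1, Φ_{-1}=ζ̄²/2, Φ_0=ζ̄, Φ_1=ζζ̄, a_0=1, a_1=0: Jacobian -2, printed value 2). *)

theory Defs
  imports
    "HOL-Complex_Analysis.Complex_Analysis"
    "Jordan_Normal_Form.Determinant"
begin

(* The inner polynomial variable is zeta, the outer one its formal conjugate. *)
definition ratfun2 :: "complex poly poly \<Rightarrow> complex poly poly \<Rightarrow> complex \<Rightarrow> complex \<Rightarrow> complex" where
  "ratfun2 p q \<zeta> w = poly (poly p [:w:]) \<zeta> / poly (poly q [:w:]) \<zeta>"

definition f_poly :: "nat \<Rightarrow> (nat \<Rightarrow> complex) \<Rightarrow> complex \<Rightarrow> complex" where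
  "f_poly n a z = z * (\<Sum>k\<le>n. a k * z ^ k)"

definition f_star :: "nat \<Rightarrow> (nat \<Rightarrow> complex) \<Rightarrow> complex \<Rightarrow> complex" where
  "f_star n a z = cnj (f_poly n a (1 / cnj z))"

definition gen_moment ::
    "nat \<Rightarrow> (complex \<Rightarrow> complex \<Rightarrow> complex) \<Rightarrow> (nat \<Rightarrow> complex) \<Rightarrow> complex" where
  "gen_moment n \<Phi> a = 1 / (2 * of_real pi * \<i>) *
     contour_integral (circlepath 0 1)
       (\<lambda>z. \<Phi> (f_poly n a z) (f_star n a z) * deriv (f_poly n a) z)"

definition residue_entry ::
    "nat \<Rightarrow> (complex \<Rightarrow> complex \<Rightarrow> complex) \<Rightarrow> (nat \<Rightarrow> complex) \<Rightarrow> int \<Rightarrow> complex" where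
  "residue_entry n \<Phi> a j = 1 / (2 * of_real pi * \<i>) *
     contour_integral (circlepath 0 1)
       (\<lambda>z. deriv (\<lambda>w. \<Phi> (f_poly n a z) w) (f_star n a z) / z powi (1 + j))"

definition wirtinger :: "(complex \<Rightarrow> complex) \<Rightarrow> complex \<Rightarrow> complex" where
  "wirtinger g z =
     (vector_derivative (\<lambda>t::real. g (z + of_real t)) (at 0)
      - \<i> * vector_derivative (\<lambda>t::real. g (z + \<i> * of_real t)) (at 0)) / 2"

definition wirtinger_cnj :: "(complex \<Rightarrow> complex) \<Rightarrow> complex \<Rightarrow> complex" where
  "wirtinger_cnj g z =
     (vector_derivative (\<lambda>t::real. g (z + of_real t)) (at 0)
      + \<i> * vector_derivative (\<lambda>t::real. g (z + \<i> * of_real t)) (at 0)) / 2"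

(* The derivative with respect to a_j for an integer j, where a_(-k) is the conjugate of a_k
   for k > 0 and a_0 is a real variable. *)
definition coeff_deriv :: "int \<Rightarrow> ((nat \<Rightarrow> complex) \<Rightarrow> complex) \<Rightarrow> (nat \<Rightarrow> complex) \<Rightarrow> complex" where
  "coeff_deriv j F a =
     (if j = 0 then vector_derivative (\<lambda>t::real. F (a(0 := of_real t))) (at (Re (a 0)))
      else if 0 < j then wirtinger (\<lambda>w. F (a(nat j := w))) (a (nat j))
      else wirtinger_cnj (\<lambda>w. F (a(nat (- j) := w))) (a (nat (- j))))"

(* Rows and columns are both ordered increasingly, from -n to n. *)
definition sym_mat :: "nat \<Rightarrow> (int \<Rightarrow> int \<Rightarrow> complex) \<Rightarrow> complex mat" where
  "sym_mat n M =
     Matrix.mat (2 * n + 1) (2 * n + 1) (\<lambda>(r, c). M (int r - int n) (int c - int n))"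

(* With this ordering the sign (-1)^n is unavoidable in the Jacobian formula: at f = a_0 z the
   Jacobian matrix is (v_kj) times an antidiagonal matrix of size 2n+1 with positive entries. *)
definition moment_jacobian ::
    "nat \<Rightarrow> (int \<Rightarrow> complex \<Rightarrow> complex \<Rightarrow> complex) \<Rightarrow> (nat \<Rightarrow> complex) \<Rightarrow> complex" where
  "moment_jacobian n \<Phi> a =
     Determinant.det (sym_mat n (\<lambda>k j. coeff_deriv j (gen_moment n (\<Phi> k)) a))"

(* The coefficient of z^k in f' for k >= 0, and in its reflection f'^* for k <= 0. *)
definition deriv_coeff :: "(nat \<Rightarrow> complex) \<Rightarrow> int \<Rightarrow> complex" where
  "deriv_coeff a k =
     (if 0 \<le> k then of_int (k + 1) * a (nat k) else of_int (1 - k) * cnj (a (nat (- k))))"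

(* In both blocks the entry in row r and column c is b_(r-c): row r < n starts with b_0 in
   column r, and row n+i starts with b_n in column i. *)
definition sylvester :: "nat \<Rightarrow> (int \<Rightarrow> complex) \<Rightarrow> complex mat" where
  "sylvester n b = Matrix.mat (2 * n) (2 * n) (\<lambda>(r, c).
     if r < n
     then (if r \<le> c \<and> c \<le> r + n then b (int r - int c) else 0)
     else (if r - n \<le> c \<and> c \<le> r then b (int r - int c) else 0))"

(* The meromorphic resultant of f' and f'^*, given in all cases, common zeros included, by the
   Sylvester determinant. *)
definition mero_resultant :: "nat \<Rightarrow> (nat \<Rightarrow> complex) \<Rightarrow> complex" where
  "mero_resultant n a =
     1 / deriv_coeff a 0 ^ (2 * n) * Determinant.det (sylvester n (deriv_coeff a))"

end

theory Submission
  imports Defs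
begin

text \<open>
  Write \<open>\<delta>f\<close> and \<open>\<delta>f\<^sup>*\<close> for the variations of $f$ and of its reflection $f^*$ caused by moving one
  coefficient. Differentiating the moment of $\Phi$ under the integral sign gives the integrand
  $(\Phi_\zeta\,\delta f + \Phi_{\bar\zeta}\,\delta f^*) f' + \Phi\,\delta f'$. On the closed contour
  the exact differential $d(\Phi(f, f^*)\,\delta f)$ may be subtracted, and all that survives is
  $\Phi_{\bar\zeta}\,(f'\,\delta f^* - f^{*\prime}\,\delta f)$: the derivative in the first variable and
  the undifferentiated $\Phi$ drop out (\<open>first_variation\<close>).

  For \<open>j \<ge> 1\<close> the Wirtinger derivative in $a_j$ has $\delta f = z^{j+1}$ and the one in $a_{-j}$ has
  $\delta f^* = z^{-j-1}$, while the real variable $a_0$ contributes both. Since $f'$ and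
  $-z^2 f^{*\prime}$ are Laurent polynomials with the coefficients $b_k$, every derivative of a moment is
  a combination of the residue entries $v_{kl}$ with coefficients $b_{-(l+j)}$
  (\<open>coeff_deriv_gen_moment\<close>). Hence the Jacobian matrix is the product of the residue matrix
  with a transition matrix \<open>T\<close> that depends only on the $b_k$.

  The determinant of \<open>T\<close> is found by reversing the order of its columns, at the cost of the sign
  \<open>(- 1) ^ n\<close>, and transposing (\<open>transition_as_doubled_sylvester\<close>). The result is a Sylvester-like
  matrix of size \<open>2n + 1\<close> whose middle row, the one of $a_0$, is the sum of the row that would
  continue the upper block and the row that would begin the lower one. Splitting that row gives two
  determinants, each equal to $b_0$ times the Sylvester determinant
  (\<open>det_doubled_sylvester\<close>). This is the origin of the factor 2.
\<close>

section \<open>Determinants of Sylvester type\<close>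

lemma det_single_entry_column:
  fixes A :: "'a :: comm_ring_1 mat"
  assumes A: "A \<in> carrier_mat N N" and i: "i < N" and j: "j < N"
    and z: "\<And>i'. i' < N \<Longrightarrow> i' \<noteq> i \<Longrightarrow> A $$ (i', j) = 0"
  shows "Determinant.det A = A $$ (i, j) * cofactor A i j"
proof -
  have "Determinant.det A = (\<Sum>i'<N. A $$ (i', j) * cofactor A i' j)"
    by (rule laplace_expansion_column[OF A j])
  also have "\<dots> = (\<Sum>i'<N. if i' = i then A $$ (i, j) * cofactor A i j else 0)"
    by (rule sum.cong) (auto simp: z)
  also have "\<dots> = A $$ (i, j) * cofactor A i j"
    using i by simp
  finally show ?thesis .
qed

text \<open>
  The cofactors along row \<open>k\<close> do not involve that row, so that they are the same for all three matrices.
\<close>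

lemma det_row_additive:
  fixes A B C :: "'a :: comm_ring_1 mat"
  assumes A: "A \<in> carrier_mat N N" and B: "B \<in> carrier_mat N N" and C: "C \<in> carrier_mat N N"
    and k: "k < N"
    and row: "\<And>j. j < N \<Longrightarrow> A $$ (k, j) = B $$ (k, j) + C $$ (k, j)"
    and AB: "\<And>i j. i < N \<Longrightarrow> j < N \<Longrightarrow> i \<noteq> k \<Longrightarrow> B $$ (i, j) = A $$ (i, j)"
    and AC: "\<And>i j. i < N \<Longrightarrow> j < N \<Longrightarrow> i \<noteq> k \<Longrightarrow> C $$ (i, j) = A $$ (i, j)"
  shows "Determinant.det A = Determinant.det B + Determinant.det C"
proof -
  have skip: "(if i < k then i else Suc i) \<noteq> k" for i
    by simp
  have "mat_delete B k j = mat_delete A k j" "mat_delete C k j = mat_delete A k j" if "j < N" for j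
    unfolding mat_delete_def using A B C that
    by (auto intro!: cong_mat AB AC skip simp del: if_cancel)
  then have cB: "cofactor B k j = cofactor A k j" and cC: "cofactor C k j = cofactor A k j"
    if "j < N" for j
    using that by (simp_all add: cofactor_def)
  show ?thesis
    unfolding laplace_expansion_row[OF A k] laplace_expansion_row[OF B k]
      laplace_expansion_row[OF C k] sum.distrib[symmetric]
    by (rule sum.cong) (auto simp: cB cC row algebra_simps)
qed

definition exchange_mat :: "nat \<Rightarrow> 'a :: comm_ring_1 mat" where
  "exchange_mat N = Matrix.mat N N (\<lambda>(i, j). if i + j + 1 = N then 1 else 0)"

text \<open>
  The first column has its only nonzero entry in the bottom corner, and deleting that row and column
  gives the next smaller exchange matrix.
\<close>

lemma det_exchange_mat: "Determinant.det (exchange_mat N :: 'a :: comm_ring_1 mat) = (-1) ^ (N choose 2)"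
proof (induction N)
  case 0
  show ?case by (simp add: exchange_mat_def numeral_2_eq_2)
next
  case (Suc N)
  have "Determinant.det (exchange_mat (Suc N) :: 'a mat)
      = exchange_mat (Suc N) $$ (N, 0) * cofactor (exchange_mat (Suc N)) N 0"
    by (rule det_single_entry_column[where N = "Suc N"]) (auto simp: exchange_mat_def)
  also have "mat_delete (exchange_mat (Suc N) :: 'a mat) N 0 = exchange_mat N"
    by (rule eq_matI) (auto simp: exchange_mat_def mat_delete_def)
  then have "cofactor (exchange_mat (Suc N) :: 'a mat) N 0 = (-1) ^ (N + 0) * (-1) ^ (N choose 2)"
    by (simp only: cofactor_def Suc)
  finally show ?case
    by (simp add: exchange_mat_def numeral_2_eq_2 power_add)
qed

text \<open>
  Rows up to the middle one, of index \<open>n\<close>, carry the shifts of $(b_0, \dots, b_{-n})$ and rows from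
  the middle one on carry the shifts of $(b_n, \dots, b_0)$. The two blocks overlap in the middle row,
  where the entries are added, so that $2 b_0$ stands in the centre.
\<close>

definition doubled_sylvester :: "nat \<Rightarrow> (int \<Rightarrow> complex) \<Rightarrow> complex mat" where
  "doubled_sylvester n b = Matrix.mat (2 * n + 1) (2 * n + 1) (\<lambda>(r, c).
     (if r \<le> n \<and> r \<le> c \<and> c \<le> r + n then b (int r - int c) else 0) +
     (if n \<le> r \<and> c \<le> r \<and> r \<le> c + n then b (int r - int c) else 0))"

text \<open>
  If the middle row is given to the lower block, the last column has the single nonzero entry $b_0$ in
  the corner; if it is given to the upper block, the same holds for the first column. Deleting the row
  and the column of that corner leaves the Sylvester matrix in both cases.
\<close>

lemma det_doubled_sylvester:
  "Determinant.det (doubled_sylvester n b) = 2 * b 0 * Determinant.det (sylvester n b)"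
proof -
  let ?N = "2 * n + 1"
  \<comment> \<open>The middle row belongs to the lower block in \<open>A\<close> and to the upper block in \<open>B\<close>.\<close>
  define A where "A = Matrix.mat ?N ?N (\<lambda>(r, c).
     if r < n then (if r \<le> c \<and> c \<le> r + n then b (int r - int c) else 0)
     else (if c \<le> r \<and> r \<le> c + n then b (int r - int c) else 0))"
  define B where "B = Matrix.mat ?N ?N (\<lambda>(r, c).
     if r \<le> n then (if r \<le> c \<and> c \<le> r + n then b (int r - int c) else 0)
     else (if c \<le> r \<and> r \<le> c + n then b (int r - int c) else 0))"
  have A: "A \<in> carrier_mat ?N ?N" and B: "B \<in> carrier_mat ?N ?N"
    by (auto simp: A_def B_def)
  have "Determinant.det (doubled_sylvester n b) = Determinant.det A + Determinant.det B"
    by (rule det_row_additive[where N = ?N and k = n])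
      (auto simp: A_def B_def doubled_sylvester_def)
  moreover have "Determinant.det A = b 0 * Determinant.det (sylvester n b)"
  proof -
    have "Determinant.det A = A $$ (2 * n, 2 * n) * cofactor A (2 * n) (2 * n)"
      by (rule det_single_entry_column[OF A]) (auto simp: A_def)
    also have "mat_delete A (2 * n) (2 * n) = sylvester n b"
      by (rule eq_matI) (auto simp: A_def sylvester_def mat_delete_def)
    then have "cofactor A (2 * n) (2 * n) = Determinant.det (sylvester n b)"
      by (simp add: cofactor_def)
    finally show ?thesis by (simp add: A_def)
  qed
  moreover have "Determinant.det B = b 0 * Determinant.det (sylvester n b)"
  proof -
    have "Determinant.det B = B $$ (0, 0) * cofactor B 0 0"
      by (rule det_single_entry_column[OF B]) (auto simp: B_def)
    also have "mat_delete B 0 0 = sylvester n b"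
      by (rule eq_matI) (auto simp: B_def sylvester_def mat_delete_def)
    then have "cofactor B 0 0 = Determinant.det (sylvester n b)"
      by (simp add: cofactor_def)
    finally show ?thesis by (simp add: B_def)
  qed
  ultimately show ?thesis by (simp add: algebra_simps)
qed

text \<open>
  The coefficient of the residue entry with index \<open>l\<close> in the derivative of a moment in $a_j$. The first
  summand stems from the variation of $f$, the second from that of $f^*$; both are present for \<open>j = 0\<close>.
\<close>

definition transition :: "nat \<Rightarrow> (int \<Rightarrow> complex) \<Rightarrow> int \<Rightarrow> int \<Rightarrow> complex" where
  "transition n b l j =
     (if 0 \<le> j \<and> l + j \<in> {0..int n} then b (- (l + j)) else 0) +
     (if j \<le> 0 \<and> l + j \<in> {- int n..0} then b (- (l + j)) else 0)"

text \<open>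
  The transition entries depend on \<open>l + j\<close>, whereas those of a Sylvester matrix depend on a difference
  of indices; reversing the columns, that is replacing \<open>j\<close> by \<open>- j\<close>, turns the one into the other.
\<close>

lemma transition_as_doubled_sylvester:
  "sym_mat n (transition n b) = (doubled_sylvester n b)\<^sup>T * exchange_mat (2 * n + 1)"
proof (rule eq_matI, goal_cases)
  case (1 r c)
  then have r: "r < 2 * n + 1" and c: "c < 2 * n + 1"
    by (auto simp: exchange_mat_def doubled_sylvester_def)
  have "((doubled_sylvester n b)\<^sup>T * exchange_mat (2 * n + 1)) $$ (r, c)
     = (\<Sum>s = 0..<2 * n + 1. doubled_sylvester n b $$ (s, r) * (if s + c + 1 = 2 * n + 1 then 1 else 0))"
    using r c by (simp add: scalar_prod_def exchange_mat_def doubled_sylvester_def)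
  also have "\<dots> = (\<Sum>s = 0..<2 * n + 1. if s = 2 * n - c then doubled_sylvester n b $$ (2 * n - c, r) else 0)"
    using c by (intro sum.cong) auto
  also have "\<dots> = doubled_sylvester n b $$ (2 * n - c, r)"
    using c by simp
  also have "\<dots> = sym_mat n (transition n b) $$ (r, c)"
  proof -
    define s where "s = 2 * n - c"
    have s: "int s = 2 * int n - int c" "s < 2 * n + 1"
      using c by (auto simp: s_def)
    have "(s \<le> n \<and> s \<le> r \<and> r \<le> s + n) \<longleftrightarrow>
        0 \<le> int c - int n \<and> int r - int n + (int c - int n) \<in> {0..int n}"
      and "(n \<le> s \<and> r \<le> s \<and> s \<le> r + n) \<longleftrightarrow>
        int c - int n \<le> 0 \<and> int r - int n + (int c - int n) \<in> {- int n..0}"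
      and "int s - int r = - (int r - int n + (int c - int n))"
      unfolding atLeastAtMost_iff using s(1) by presburger+
    then show ?thesis
      using r c s(2)
      by (simp only: s_def[symmetric] doubled_sylvester_def sym_mat_def transition_def
          index_mat prod.case if_True)
  qed
  finally show ?case by simp
qed (auto simp: sym_mat_def exchange_mat_def doubled_sylvester_def)

text \<open>
  The exponent of the exchange determinant in odd dimension, written so that its parity is visibly
  that of \<open>n\<close>.
\<close>

lemma choose_two_odd: "(2 * n + 1) choose 2 = 2 * (n * n) + n"
  by (simp add: choose_two algebra_simps)

lemma det_transition:
  "Determinant.det (sym_mat n (transition n b))
     = (- 1) ^ n * (2 * b 0 * Determinant.det (sylvester n b))"
proof -
  have U: "doubled_sylvester n b \<in> carrier_mat (2 * n + 1) (2 * n + 1)"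
    and E: "exchange_mat (2 * n + 1) \<in> carrier_mat (2 * n + 1) (2 * n + 1)"
    by (auto simp: doubled_sylvester_def exchange_mat_def)
  have "Determinant.det (sym_mat n (transition n b)) =
      Determinant.det ((doubled_sylvester n b)\<^sup>T) *
      Determinant.det (exchange_mat (2 * n + 1) :: complex mat)"
    unfolding transition_as_doubled_sylvester
    by (rule det_mult) (use U E in auto)
  then show ?thesis
    unfolding det_transpose[OF U] det_exchange_mat choose_two_odd det_doubled_sylvester
    by (simp add: power_add power_mult)
qed

lemma sym_mat_mult:
  assumes "\<And>k j. k \<in> {- int n..int n} \<Longrightarrow> j \<in> {- int n..int n} \<Longrightarrow>
     M k j = (\<Sum>l = - int n..int n. V k l * T l j)"
  shows "sym_mat n M = sym_mat n V * sym_mat n T"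
proof (rule eq_matI, goal_cases)
  case (1 r c)
  then have r: "r < 2 * n + 1" and c: "c < 2 * n + 1"
    by (auto simp: sym_mat_def)
  have "(\<Sum>l = - int n..int n. V (int r - int n) l * T l (int c - int n)) =
      (\<Sum>s = 0..<2 * n + 1. V (int r - int n) (int s - int n) * T (int s - int n) (int c - int n))"
    by (rule sum.reindex_bij_witness[where i = "\<lambda>s. int s - int n" and j = "\<lambda>l. nat (l + int n)"])
      auto
  then show ?case
    using r c by (simp add: sym_mat_def scalar_prod_def assms)
qed (auto simp: sym_mat_def)

section \<open>Differentiation of rational functions and of contour integrals\<close>

text \<open>
  Isolating the evaluation lets the rules of calculus be proved by induction on a single polynomial
  before a quotient is formed.
\<close>

definition eval2 :: "complex poly poly \<Rightarrow> complex \<Rightarrow> complex \<Rightarrow> complex" where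
  "eval2 p \<zeta> w = poly (poly p [:w:]) \<zeta>"

lemma ratfun2_eval2: "ratfun2 p q \<zeta> w = eval2 p \<zeta> w / eval2 q \<zeta> w"
  by (simp add: ratfun2_def eval2_def)

lemma eval2_0 [simp]: "eval2 0 \<zeta> w = 0"
  and eval2_pCons [simp]: "eval2 (pCons c p) \<zeta> w = poly c \<zeta> + w * eval2 p \<zeta> w"
  and eval2_add [simp]: "eval2 (p + q) \<zeta> w = eval2 p \<zeta> w + eval2 q \<zeta> w"
  and eval2_diff [simp]: "eval2 (p - q) \<zeta> w = eval2 p \<zeta> w - eval2 q \<zeta> w"
  and eval2_mult [simp]: "eval2 (p * q) \<zeta> w = eval2 p \<zeta> w * eval2 q \<zeta> w"
  by (simp_all add: eval2_def)

lemma has_derivative_eval2: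
  fixes x y :: "'a :: real_normed_vector \<Rightarrow> complex"
  assumes x: "(x has_derivative x') (at t within S)"
    and y: "(y has_derivative y') (at t within S)"
  shows "((\<lambda>t. eval2 p (x t) (y t)) has_derivative
     (\<lambda>h. eval2 (map_poly pderiv p) (x t) (y t) * x' h + eval2 (pderiv p) (x t) (y t) * y' h))
     (at t within S)"
proof (induction p)
  case 0
  show ?case by simp
next
  case (pCons c p)
  have c: "((\<lambda>t. poly c (x t)) has_derivative (\<lambda>h. poly (pderiv c) (x t) * x' h)) (at t within S)"
    by (rule has_derivative_compose[OF x poly_DERIV[unfolded has_field_derivative_def]])
  show ?case
    unfolding eval2_pCons
    by (rule has_derivative_eq_rhs[OF has_derivative_add[OF c has_derivative_mult[OF y pCons.IH]]])
      (simp add: fun_eq_iff map_poly_pCons pderiv_pCons algebra_simps)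
qed

lemma continuous_on_eval2 [continuous_intros]:
  fixes x y :: "'a :: topological_space \<Rightarrow> complex"
  assumes "continuous_on S x" "continuous_on S y"
  shows "continuous_on S (\<lambda>t. eval2 p (x t) (y t))"
  by (induction p) (auto intro!: continuous_intros assms)

text \<open>
  By the quotient rule the partial derivatives of \<open>p / q\<close> are again rational functions, with the
  denominator \<open>q * q\<close> and the numerators below, so that continuity and evaluation lemmas apply to
  them unchanged. The variable $\zeta$ lives in the coefficients, whence the coefficientwise derivative.
\<close>

definition partial1_num :: "complex poly poly \<Rightarrow> complex poly poly \<Rightarrow> complex poly poly" where
  "partial1_num p q = map_poly pderiv p * q - p * map_poly pderiv q"

definition partial2_num :: "complex poly poly \<Rightarrow> complex poly poly \<Rightarrow> complex poly poly" where
  "partial2_num p q = pderiv p * q - p * pderiv q"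

lemma has_derivative_ratfun2:
  fixes x y :: "'a :: real_normed_vector \<Rightarrow> complex"
  assumes x: "(x has_derivative x') (at t within S)"
    and y: "(y has_derivative y') (at t within S)"
    and q: "eval2 q (x t) (y t) \<noteq> 0"
  shows "((\<lambda>t. ratfun2 p q (x t) (y t)) has_derivative
     (\<lambda>h. ratfun2 (partial1_num p q) (q * q) (x t) (y t) * x' h
        + ratfun2 (partial2_num p q) (q * q) (x t) (y t) * y' h)) (at t within S)"
  unfolding ratfun2_eval2
  by (rule has_derivative_eq_rhs[OF has_derivative_divide'[OF
        has_derivative_eval2[OF x y] has_derivative_eval2[OF x y] q]])
    (use q in \<open>simp add: fun_eq_iff partial1_num_def partial2_num_def field_simps\<close>)

lemma continuous_on_ratfun2 [continuous_intros]:
  fixes x y :: "'a :: topological_space \<Rightarrow> complex"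
  assumes "continuous_on S x" "continuous_on S y" "\<And>t. t \<in> S \<Longrightarrow> eval2 q (x t) (y t) \<noteq> 0"
  shows "continuous_on S (\<lambda>t. ratfun2 p q (x t) (y t))"
  unfolding ratfun2_eval2 using assms by (auto intro!: continuous_intros)

lemma has_field_derivative_ratfun2:
  assumes x: "(x has_field_derivative x') (at z within S)"
    and y: "(y has_field_derivative y') (at z within S)"
    and q: "eval2 q (x z) (y z) \<noteq> 0"
  shows "((\<lambda>z. ratfun2 p q (x z) (y z)) has_field_derivative
     (ratfun2 (partial1_num p q) (q * q) (x z) (y z) * x'
        + ratfun2 (partial2_num p q) (q * q) (x z) (y z) * y')) (at z within S)"
  using has_derivative_ratfun2[OF x[unfolded has_field_derivative_def]
      y[unfolded has_field_derivative_def] q]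
  unfolding has_field_derivative_def
  by (rule has_derivative_eq_rhs) (simp add: fun_eq_iff algebra_simps)

lemma deriv_ratfun2:
  assumes "eval2 q \<zeta> w \<noteq> 0"
  shows "deriv (\<lambda>w. ratfun2 p q \<zeta> w) w = ratfun2 (partial2_num p q) (q * q) \<zeta> w"
  using has_field_derivative_ratfun2[of "\<lambda>_. \<zeta>" 0 w UNIV "\<lambda>w. w" 1 q p] assms
  by (intro DERIV_imp_deriv) simp

text \<open>
  The parameters \<open>t\<close> in \<open>{-1..1}\<close> for which the denominator vanishes somewhere on the compact set \<open>C\<close>
  form the projection of a compact set. They are a closed set that avoids 0.
\<close>

lemma denominator_stable:
  fixes f g \<xi> \<eta> :: "complex \<Rightarrow> complex"
  assumes C: "compact C"
    and cont: "continuous_on C f" "continuous_on C g" "continuous_on C \<xi>" "continuous_on C \<eta>"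
    and q: "\<And>z. z \<in> C \<Longrightarrow> eval2 q (f z) (g z) \<noteq> 0"
  obtains \<delta> :: real where "\<delta> > 0"
    "\<And>t z. t \<in> ball 0 \<delta> \<Longrightarrow> z \<in> C \<Longrightarrow> eval2 q (f z + of_real t * \<xi> z) (g z + of_real t * \<eta> z) \<noteq> 0"
proof -
  define E where "E = (\<lambda>(t::real, z). eval2 q (f z + of_real t * \<xi> z) (g z + of_real t * \<eta> z))"
  define W where "W = (({-1..1} \<times> C) \<inter> E -` {0})"
  note [continuous_intros] = cont[THEN continuous_on_compose2]
  have "continuous_on ({-1..1} \<times> C) E"
    unfolding E_def split_beta by (auto intro!: continuous_intros)
  then have "closed W"
    unfolding W_def using C
    by (intro continuous_closed_preimage) (auto intro!: compact_imp_closed compact_Times)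
  then have "compact W"
    using compact_Int_closed[of "{-1..1} \<times> C" W] C
    by (auto simp: W_def compact_Times Int_absorb1 Int_assoc[symmetric])
  then have "closed (fst ` W)"
    by (intro compact_imp_closed compact_continuous_image continuous_intros)
  moreover have "0 \<notin> fst ` W"
    using q by (auto simp: W_def E_def)
  ultimately have "open ({-1<..<1} - fst ` W)" "0 \<in> {-1<..<1} - fst ` W"
    by auto
  then obtain \<delta> where \<delta>: "\<delta> > 0" "ball 0 \<delta> \<subseteq> {-1<..<1} - fst ` W"
    unfolding open_contains_ball by blast
  show ?thesis
  proof (rule that[OF \<delta>(1)])
    fix t :: real and z assume t: "t \<in> ball 0 \<delta>" and z: "z \<in> C"
    have tt: "t \<in> {-1<..<1}" "t \<notin> fst ` W" using \<delta>(2) t by blast+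
    show "eval2 q (f z + of_real t * \<xi> z) (g z + of_real t * \<eta> z) \<noteq> 0"
    proof
      assume "eval2 q (f z + of_real t * \<xi> z) (g z + of_real t * \<eta> z) = 0"
      then have "(t, z) \<in> W" using tt z by (auto simp: W_def E_def)
      then show False using tt by force
    qed
  qed
qed

text \<open>
  The differentiated integrand differs from the stated one by the derivative of
  \<open>\<Phi>(f z, g z) * \<xi> z\<close> along the circle, whose integral over the closed contour is zero. The functions
  need only be differentiable along the circle, because that suffices for a primitive to be integrated.
\<close>

lemma first_variation:
  fixes f f' g g' \<xi> \<xi>' \<eta> :: "complex \<Rightarrow> complex" and c :: complex and r :: real
  defines "C \<equiv> path_image (circlepath c r)"
  assumes f: "\<And>z. z \<in> C \<Longrightarrow> (f has_field_derivative f' z) (at z within C)"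
    and g: "\<And>z. z \<in> C \<Longrightarrow> (g has_field_derivative g' z) (at z within C)"
    and \<xi>: "\<And>z. z \<in> C \<Longrightarrow> (\<xi> has_field_derivative \<xi>' z) (at z within C)"
    and cont: "continuous_on C f'" "continuous_on C g'" "continuous_on C \<xi>'" "continuous_on C \<eta>"
    and q: "\<And>z. z \<in> C \<Longrightarrow> eval2 q (f z) (g z) \<noteq> 0"
  shows "((\<lambda>t::real. contour_integral (circlepath c r) (\<lambda>z.
        ratfun2 p q (f z + of_real t * \<xi> z) (g z + of_real t * \<eta> z) * (f' z + of_real t * \<xi>' z)))
      has_vector_derivative
        contour_integral (circlepath c r) (\<lambda>z.
          ratfun2 (partial2_num p q) (q * q) (f z) (g z) * (f' z * \<eta> z - g' z * \<xi> z))) (at 0)"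
proof -
  define \<gamma> where "\<gamma> = circlepath c r"
  define R R1 R2 where "R = ratfun2 p q" and "R1 = ratfun2 (partial1_num p q) (q * q)"
    and "R2 = ratfun2 (partial2_num p q) (q * q)"
  define d where "d = (\<lambda>s. vector_derivative \<gamma> (at s))"
  have \<gamma>C: "\<gamma> s \<in> C" if "s \<in> {0..1}" for s
    using that by (auto simp: C_def \<gamma>_def path_image_def)
  have cfg: "continuous_on C f" "continuous_on C g" "continuous_on C \<xi>"
    using f g \<xi> by (blast intro: DERIV_continuous_on)+
  have "compact C" unfolding C_def by (intro compact_path_image) auto
  from denominator_stable[OF this cfg cont(4) q] obtain \<delta> :: real where \<delta>: "\<delta> > 0"
    and q\<delta>: "\<And>t z. t \<in> ball 0 \<delta> \<Longrightarrow> z \<in> C \<Longrightarrow>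
        eval2 q (f z + of_real t * \<xi> z) (g z + of_real t * \<eta> z) \<noteq> 0"
    by metis
  have d: "continuous_on A d" for A
    unfolding d_def \<gamma>_def vector_derivative_circlepath by (intro continuous_intros)
  have \<gamma>: "continuous_on {0..1} \<gamma>"
    unfolding \<gamma>_def using path_def path_circlepath by blast
  note con [continuous_intros] = cfg[THEN continuous_on_compose2] cont[THEN continuous_on_compose2]
    \<gamma>[THEN continuous_on_compose2] d[of UNIV, THEN continuous_on_compose2]
  \<comment> \<open>\<open>F'\<close> is the derivative of the integrand \<open>F\<close> in the parameter \<open>t\<close>.\<close>
  let ?U = "ball 0 \<delta> :: real set"
  define F where "F = (\<lambda>t z. R (f z + of_real t * \<xi> z) (g z + of_real t * \<eta> z) * (f' z + of_real t * \<xi>' z))"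
  define F' where "F' = (\<lambda>t z.
      (R1 (f z + of_real t * \<xi> z) (g z + of_real t * \<eta> z) * \<xi> z
        + R2 (f z + of_real t * \<xi> z) (g z + of_real t * \<eta> z) * \<eta> z) * (f' z + of_real t * \<xi>' z)
      + R (f z + of_real t * \<xi> z) (g z + of_real t * \<eta> z) * \<xi>' z)"
  have F: "((\<lambda>t. F t z) has_vector_derivative F' t z) (at t within ?U)"
    if t: "t \<in> ?U" and z: "z \<in> C" for t z
  proof -
    have lin: "((\<lambda>t. u + of_real t * v) has_derivative (\<lambda>h. of_real h * v)) (at t within ?U)"
      for u v :: complex
      by (auto intro!: derivative_eq_intros)
    have "((\<lambda>t. R (f z + of_real t * \<xi> z) (g z + of_real t * \<eta> z)) has_derivative
       (\<lambda>h. R1 (f z + of_real t * \<xi> z) (g z + of_real t * \<eta> z) * (of_real h * \<xi> z)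
        + R2 (f z + of_real t * \<xi> z) (g z + of_real t * \<eta> z) * (of_real h * \<eta> z))) (at t within ?U)"
      unfolding R_def R1_def R2_def by (rule has_derivative_ratfun2[OF lin lin q\<delta>[OF t z]])
    from has_derivative_mult[OF this lin[of "f' z" "\<xi>' z"]] show ?thesis
      unfolding has_vector_derivative_def F_def
      by (rule has_derivative_eq_rhs) (simp add: fun_eq_iff F'_def scaleR_conv_of_real algebra_simps)
  qed
  have cF: "continuous_on {0..1} (\<lambda>s. F t (\<gamma> s) * d s)" if "t \<in> ?U" for t
    unfolding F_def R_def using q\<delta>[OF that] \<gamma>C by (auto intro!: continuous_intros)
  have cF': "continuous_on (?U \<times> {0..1}) (\<lambda>(t, s). F' t (\<gamma> s) * d s)"
    unfolding F'_def R_def R1_def R2_def split_beta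
    using q\<delta> \<gamma>C by (auto intro!: continuous_intros)
  have "((\<lambda>t. integral (cbox 0 1) (\<lambda>s. F t (\<gamma> s) * d s)) has_vector_derivative
      integral (cbox 0 1) (\<lambda>s. F' 0 (\<gamma> s) * d s)) (at 0 within ?U)"
  proof (rule leibniz_rule_vector_derivative)
    show "((\<lambda>t. F t (\<gamma> s) * d s) has_vector_derivative F' t (\<gamma> s) * d s) (at t within ?U)"
      if "t \<in> ?U" "s \<in> cbox 0 1" for t s
      using has_vector_derivative_mult_left[OF F[OF that(1) \<gamma>C]] that(2) by auto
  qed (use cF cF' \<delta> in \<open>auto intro!: integrable_continuous_real\<close>)
  then have D: "((\<lambda>t. contour_integral \<gamma> (F t)) has_vector_derivative contour_integral \<gamma> (F' 0)) (at 0)"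
    using \<delta> unfolding contour_integral_integral d_def
    by (simp add: at_within_open[of 0 "ball 0 \<delta>"])
  \<comment> \<open>\<open>?G\<close> is the derivative of \<open>\<Phi>(f, g) * \<xi>\<close>, and \<open>F' 0\<close> equals \<open>?V + ?G\<close>.\<close>
  let ?G = "\<lambda>z. (R1 (f z) (g z) * f' z + R2 (f z) (g z) * g' z) * \<xi> z + R (f z) (g z) * \<xi>' z"
  let ?V = "\<lambda>z. R2 (f z) (g z) * (f' z * \<eta> z - g' z * \<xi> z)"
  have "((\<lambda>z. R (f z) (g z) * \<xi> z) has_field_derivative ?G z) (at z within C)" if "z \<in> C" for z
    using DERIV_mult[OF has_field_derivative_ratfun2[OF f[OF that] g[OF that] q[OF that]] \<xi>[OF that]]
    unfolding R_def R1_def R2_def by (simp add: algebra_simps)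
  from contour_integral_primitive[OF this, of \<gamma>] have G: "(?G has_contour_integral 0) \<gamma>"
    by (simp add: \<gamma>_def C_def)
  have "continuous_on C ?V"
    unfolding R2_def using q cfg cont by (auto intro!: continuous_intros)
  then have "?V contour_integrable_on \<gamma>"
    unfolding \<gamma>_def C_def by (rule contour_integrable_continuous_circlepath)
  from has_contour_integral_add[OF has_contour_integral_integral[OF this] G]
  have "((\<lambda>z. ?V z + ?G z) has_contour_integral contour_integral \<gamma> ?V) \<gamma>" by simp
  moreover have "(\<lambda>z. ?V z + ?G z) = F' 0"
    by (simp add: fun_eq_iff F'_def algebra_simps)
  ultimately have "contour_integral \<gamma> (F' 0) = contour_integral \<gamma> ?V"
    by (simp add: contour_integral_unique)
  with D show ?thesis
    unfolding F_def R_def R2_def \<gamma>_def by simp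
qed

section \<open>Derivatives of the generalized moments\<close>

lemma f_poly_eq: "f_poly n a z = (\<Sum>k\<le>n. a k * z ^ (k + 1))"
  by (simp add: f_poly_def sum_distrib_left algebra_simps)

text \<open>
  In this form the reflection is visibly a polynomial in \<open>inverse z\<close>, hence differentiable in \<open>z\<close> away
  from 0, and conjugate-linear in the coefficients. The value at 0 agrees as well, because division by
  zero yields zero.
\<close>

lemma f_star_eq: "f_star n a z = (\<Sum>k\<le>n. cnj (a k) * inverse z ^ (k + 1))"
  by (simp add: f_star_def f_poly_eq divide_inverse)

lemma f_poly_upd:
  assumes "j \<le> n"
  shows "f_poly n (a(j := a j + w)) z = f_poly n a z + w * z ^ (j + 1)"
proof -
  have "f_poly n (a(j := a j + w)) z = (\<Sum>k\<le>n. a k * z ^ (k + 1) + (if k = j then w * z ^ (j + 1) else 0))"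
    unfolding f_poly_eq by (rule sum.cong) (auto simp: algebra_simps)
  then show ?thesis using assms by (simp add: sum.distrib f_poly_eq)
qed

lemma f_star_upd:
  assumes "j \<le> n"
  shows "f_star n (a(j := a j + w)) z = f_star n a z + cnj w * inverse z ^ (j + 1)"
proof -
  have "f_star n (a(j := a j + w)) z
      = (\<Sum>k\<le>n. cnj (a k) * inverse z ^ (k + 1) + (if k = j then cnj w * inverse z ^ (j + 1) else 0))"
    unfolding f_star_eq by (rule sum.cong) (auto simp: algebra_simps)
  then show ?thesis using assms by (simp add: sum.distrib f_star_eq)
qed

lemma deriv_coeff_nonneg: "deriv_coeff a (int k) = of_nat (k + 1) * a k"
  by (simp add: deriv_coeff_def)

lemma deriv_coeff_nonpos:
  assumes "a 0 \<in> \<real>"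
  shows "deriv_coeff a (- int k) = of_nat (k + 1) * cnj (a k)"
  using assms by (cases "k = 0") (auto simp: deriv_coeff_def Reals_cnj_iff)

lemma monomial_has_field_derivative:
  fixes c z :: complex
  shows "((\<lambda>z. c * z ^ (k + 1)) has_field_derivative c * (of_nat (k + 1) * z ^ k)) (at z within S)"
  by (rule DERIV_cong[OF DERIV_cmult[OF DERIV_power[OF DERIV_ident]]]) simp

lemma f_poly_has_field_derivative:
  "(f_poly n a has_field_derivative (\<Sum>k\<le>n. deriv_coeff a (int k) * z ^ k)) (at z within S)"
proof -
  have "((\<lambda>z. \<Sum>k\<le>n. a k * z ^ (k + 1)) has_field_derivative
      (\<Sum>k\<le>n. deriv_coeff a (int k) * z ^ k)) (at z within S)"
    by (rule DERIV_sum, rule DERIV_cong[OF monomial_has_field_derivative])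
      (simp add: deriv_coeff_nonneg algebra_simps)
  then show ?thesis by (simp add: f_poly_eq[abs_def])
qed

lemma f_star_has_field_derivative:
  assumes "a 0 \<in> \<real>" "z \<noteq> 0"
  shows "(f_star n a has_field_derivative
     - (\<Sum>k\<le>n. deriv_coeff a (- int k) * inverse z ^ (k + 2))) (at z within S)"
proof -
  have "((\<lambda>z. \<Sum>k\<le>n. cnj (a k) * inverse z ^ (k + 1)) has_field_derivative
      (\<Sum>k\<le>n. - (deriv_coeff a (- int k) * inverse z ^ (k + 2)))) (at z within S)"
  proof (rule DERIV_sum)
    fix k
    have "((\<lambda>z. cnj (a k) * inverse z ^ (k + 1)) has_field_derivative
        cnj (a k) * (of_nat (k + 1) * inverse z ^ k) * (- (inverse z ^ Suc (Suc 0)))) (at z within S)"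
      by (rule DERIV_chain2[OF monomial_has_field_derivative DERIV_inverse[OF assms(2)]])
    then show "((\<lambda>z. cnj (a k) * inverse z ^ (k + 1)) has_field_derivative
        - (deriv_coeff a (- int k) * inverse z ^ (k + 2))) (at z within S)"
      by (simp add: deriv_coeff_nonpos[where a = a, OF assms(1)] algebra_simps)
  qed
  then show ?thesis by (simp add: f_star_eq[abs_def] sum_negf)
qed

text \<open>
  The derivative of \<open>\<Phi>\<close> in its second variable, taken along the curve, is a fixed continuous density
  against which all derivatives of the moment and all residue entries are integrals of Laurent
  polynomials.
\<close>

context
  fixes n :: nat and p q :: "complex poly poly" and a :: "nat \<Rightarrow> complex"
  assumes a0: "a 0 \<in> \<real>"
    and q: "\<And>z. cmod z = 1 \<Longrightarrow> eval2 q (f_poly n a z) (f_star n a z) \<noteq> 0"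
begin

definition density :: "complex \<Rightarrow> complex" where
  "density z = ratfun2 (partial2_num p q) (q * q) (f_poly n a z) (f_star n a z)"

lemma f_star_has_field_derivative_circle:
  assumes "cmod z = 1"
  shows "(f_star n a has_field_derivative
     - (\<Sum>k\<le>n. deriv_coeff a (- int k) * inverse z ^ (k + 2))) (at z within S)"
  using assms by (intro f_star_has_field_derivative[where a = a, OF a0]) auto

lemma continuous_on_density: "continuous_on (sphere 0 1) density"
proof -
  have "continuous_on (sphere 0 1) (f_poly n a)" "continuous_on (sphere 0 1) (f_star n a)"
    using f_poly_has_field_derivative f_star_has_field_derivative_circle
    by (auto intro!: DERIV_continuous_on)
  then show ?thesis
    unfolding density_def[abs_def] using q by (auto intro!: continuous_intros)
qed

lemma residue_entry_density:
  "residue_entry n (ratfun2 p q) a l = 1 / (2 * of_real pi * \<i>) *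
     contour_integral (circlepath 0 1) (\<lambda>z. density z / z powi (1 + l))"
  unfolding residue_entry_def
  by (intro arg_cong2[where f = "(*)"] refl contour_integral_cong)
    (auto simp: density_def deriv_ratfun2 q)

lemma sum_residue_entry:
  fixes N :: nat and l :: "nat \<Rightarrow> int"
  shows
  "(\<Sum>m\<le>N. c m * residue_entry n (ratfun2 p q) a (l m)) = 1 / (2 * of_real pi * \<i>) *
     contour_integral (circlepath 0 1) (\<lambda>z. density z * (\<Sum>m\<le>N. c m / z powi (1 + l m)))"
proof -
  have int: "(\<lambda>z. density z / z powi (1 + i)) contour_integrable_on circlepath 0 1" for i
    by (rule contour_integrable_continuous_circlepath)
      (auto intro!: continuous_intros continuous_on_density)
  have "contour_integral (circlepath 0 1) (\<lambda>z. density z * (\<Sum>m\<le>N. c m / z powi (1 + l m)))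
     = contour_integral (circlepath 0 1) (\<lambda>z. \<Sum>m\<le>N. c m * (density z / z powi (1 + l m)))"
    by (simp add: sum_distrib_left algebra_simps)
  also have "\<dots> = (\<Sum>m\<le>N. contour_integral (circlepath 0 1) (\<lambda>z. c m * (density z / z powi (1 + l m))))"
    by (rule contour_integral_sum) (auto intro!: contour_integrable_lmul int simp del: times_divide_eq_right)
  also have "\<dots> = (\<Sum>m\<le>N. c m * contour_integral (circlepath 0 1) (\<lambda>z. density z / z powi (1 + l m)))"
    by (simp only: contour_integral_lmul[OF int])
  finally show ?thesis
    by (simp add: residue_entry_density sum_distrib_left sum_divide_distrib algebra_simps)
qed

text \<open>
  Moving $a_j$ in the direction \<open>u\<close> varies $f$ by \<open>u * z ^ (j + 1)\<close> and $f^*$ by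
  \<open>cnj u * inverse z ^ (j + 1)\<close>. Expanding the derivatives of $f^*$ and $f$ that multiply these variations
  into powers of \<open>z\<close> produces the residue entries.
\<close>

lemma gen_moment_directional:
  assumes "j \<le> n"
  shows "((\<lambda>t::real. gen_moment n (ratfun2 p q) (a(j := a j + u * of_real t))) has_vector_derivative
     cnj u * (\<Sum>m\<le>n. deriv_coeff a (int m) * residue_entry n (ratfun2 p q) a (int j - int m)) +
     u * (\<Sum>m\<le>n. deriv_coeff a (- int m) * residue_entry n (ratfun2 p q) a (int m - int j))) (at 0)"
proof -
  let ?C = "path_image (circlepath 0 1)" and ?K = "1 / (2 * of_real pi * \<i>) :: complex"
  let ?f' = "\<lambda>z. \<Sum>k\<le>n. deriv_coeff a (int k) * z ^ k"
    and ?g' = "\<lambda>z. - (\<Sum>k\<le>n. deriv_coeff a (- int k) * inverse z ^ (k + 2))"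
    and ?\<xi> = "\<lambda>z. u * z ^ (j + 1)" and ?\<xi>' = "\<lambda>z. u * (of_nat (j + 1) * z ^ j)"
    and ?\<eta> = "\<lambda>z. cnj u * inverse z ^ (j + 1)"
  have "((\<lambda>t::real. contour_integral (circlepath 0 1) (\<lambda>z.
        ratfun2 p q (f_poly n a z + of_real t * ?\<xi> z) (f_star n a z + of_real t * ?\<eta> z)
          * (?f' z + of_real t * ?\<xi>' z)))
      has_vector_derivative
        contour_integral (circlepath 0 1) (\<lambda>z. density z * (?f' z * ?\<eta> z - ?g' z * ?\<xi> z))) (at 0)"
    unfolding density_def
  proof (rule first_variation)
    show "(?\<xi> has_field_derivative ?\<xi>' z) (at z within ?C)" for z
      by (rule monomial_has_field_derivative)
  qed (use f_poly_has_field_derivative f_star_has_field_derivative_circle q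
      in \<open>auto intro!: continuous_intros\<close>)
  then have D: "((\<lambda>t::real. ?K * contour_integral (circlepath 0 1) (\<lambda>z.
        ratfun2 p q (f_poly n a z + of_real t * ?\<xi> z) (f_star n a z + of_real t * ?\<eta> z)
          * (?f' z + of_real t * ?\<xi>' z)))
      has_vector_derivative
        ?K * contour_integral (circlepath 0 1) (\<lambda>z. density z * (?f' z * ?\<eta> z - ?g' z * ?\<xi> z))) (at 0)"
    by (rule has_vector_derivative_mult_right)
  have moment: "gen_moment n (ratfun2 p q) (a(j := a j + u * of_real t)) =
      ?K * contour_integral (circlepath 0 1) (\<lambda>z.
        ratfun2 p q (f_poly n a z + of_real t * ?\<xi> z) (f_star n a z + of_real t * ?\<eta> z)
          * (?f' z + of_real t * ?\<xi>' z))" for t :: real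
  proof -
    have fp: "f_poly n (a(j := a j + u * of_real t)) = (\<lambda>z. f_poly n a z + of_real t * ?\<xi> z)"
      by (simp add: f_poly_upd[OF assms] fun_eq_iff)
    have "deriv (\<lambda>z. f_poly n a z + of_real t * ?\<xi> z) z = ?f' z + of_real t * ?\<xi>' z" for z
      by (rule DERIV_imp_deriv[OF DERIV_add[OF f_poly_has_field_derivative
            DERIV_cmult[OF monomial_has_field_derivative]]])
    then show ?thesis
      unfolding gen_moment_def fp by (simp add: f_star_upd[OF assms] mult.assoc mult.left_commute)
  qed
  \<comment> \<open>The exponents are arranged so that each term is the kernel of one residue entry.\<close>
  have split: "?f' z * ?\<eta> z - ?g' z * ?\<xi> z =
      (\<Sum>m\<le>n. (cnj u * deriv_coeff a (int m)) / z powi (1 + (int j - int m))) +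
      (\<Sum>m\<le>n. (u * deriv_coeff a (- int m)) / z powi (1 + (int m - int j)))"
    if "z \<noteq> 0" for z
  proof -
    have 1: "z ^ m * inverse z ^ (j + 1) = 1 / z powi (1 + (int j - int m))" for m
    proof -
      have "z powi (1 + (int j - int m)) = z powi (int (j + 1) - int m)" by (simp add: algebra_simps)
      also have "\<dots> = z ^ (j + 1) / z ^ m"
        using that by (simp only: power_int_diff power_int_of_nat simp_thms)
      finally show ?thesis by (simp add: field_simps)
    qed
    have 2: "inverse z ^ (m + 2) * z ^ (j + 1) = 1 / z powi (1 + (int m - int j))" for m
    proof -
      have "z powi (1 + (int m - int j)) = z powi (int (m + 2) - int (j + 1))" by (simp add: algebra_simps)
      also have "\<dots> = z ^ (m + 2) / z ^ (j + 1)"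
        using that by (simp only: power_int_diff power_int_of_nat simp_thms)
      finally show ?thesis using that by (simp add: field_simps)
    qed
    have "?f' z * ?\<eta> z = (\<Sum>m\<le>n. cnj u * deriv_coeff a (int m) * (z ^ m * inverse z ^ (j + 1)))"
      by (simp only: sum_distrib_right) (simp only: ac_simps)
    moreover have "- ?g' z * ?\<xi> z = (\<Sum>m\<le>n. u * deriv_coeff a (- int m) * (inverse z ^ (m + 2) * z ^ (j + 1)))"
      by (simp only: sum_distrib_right minus_minus) (simp only: ac_simps)
    ultimately show ?thesis unfolding 1 2 by simp
  qed
  have int: "(\<lambda>z. density z * (\<Sum>m\<le>n. c m / z powi (i m))) contour_integrable_on circlepath 0 1" for c i
    by (rule contour_integrable_continuous_circlepath)
      (auto intro!: continuous_intros continuous_on_density)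
  have "contour_integral (circlepath 0 1) (\<lambda>z. density z * (?f' z * ?\<eta> z - ?g' z * ?\<xi> z)) =
     contour_integral (circlepath 0 1) (\<lambda>z.
       density z * (\<Sum>m\<le>n. (cnj u * deriv_coeff a (int m)) / z powi (1 + (int j - int m))) +
       density z * (\<Sum>m\<le>n. (u * deriv_coeff a (- int m)) / z powi (1 + (int m - int j))))"
  proof (rule contour_integral_cong[OF refl])
    fix z :: complex
    assume "z \<in> ?C"
    then have "z \<noteq> 0" by auto
    from split[OF this] show "density z * (?f' z * ?\<eta> z - ?g' z * ?\<xi> z) = 
       density z * (\<Sum>m\<le>n. (cnj u * deriv_coeff a (int m)) / z powi (1 + (int j - int m))) +
       density z * (\<Sum>m\<le>n. (u * deriv_coeff a (- int m)) / z powi (1 + (int m - int j)))"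
      by (simp only: distrib_left)
  qed
  also have "\<dots> = contour_integral (circlepath 0 1) (\<lambda>z.
       density z * (\<Sum>m\<le>n. (cnj u * deriv_coeff a (int m)) / z powi (1 + (int j - int m)))) +
     contour_integral (circlepath 0 1) (\<lambda>z.
       density z * (\<Sum>m\<le>n. (u * deriv_coeff a (- int m)) / z powi (1 + (int m - int j))))"
    by (rule contour_integral_add[OF int int])
  finally have "?K * contour_integral (circlepath 0 1) (\<lambda>z. density z * (?f' z * ?\<eta> z - ?g' z * ?\<xi> z)) =
     cnj u * (\<Sum>m\<le>n. deriv_coeff a (int m) * residue_entry n (ratfun2 p q) a (int j - int m)) +
     u * (\<Sum>m\<le>n. deriv_coeff a (- int m) * residue_entry n (ratfun2 p q) a (int m - int j))"
    by (simp only: distrib_left sum_residue_entry[symmetric]) (simp only: sum_distrib_left mult.assoc)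
  with D show ?thesis by (simp only: moment)
qed

end

text \<open>
  A real differential has the form \<open>cnj u * A + u * B\<close>; the two Wirtinger operators, which combine the
  directions 1 and \<open>\<i>\<close>, pick out its complex linear and its conjugate linear part.
\<close>

lemma wirtinger_eq:
  assumes "\<And>u. ((\<lambda>t::real. g (z + u * of_real t)) has_vector_derivative cnj u * A + u * B) (at 0)"
  shows "wirtinger g z = B" "wirtinger_cnj g z = A"
proof -
  have 1: "vector_derivative (\<lambda>t::real. g (z + of_real t)) (at 0) = A + B"
    using vector_derivative_at[OF assms[of 1]] by simp
  have 2: "vector_derivative (\<lambda>t::real. g (z + \<i> * of_real t)) (at 0) = - \<i> * A + \<i> * B"
    using vector_derivative_at[OF assms[of \<i>]] by simp
  show "wirtinger g z = B" "wirtinger_cnj g z = A"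
    unfolding wirtinger_def wirtinger_cnj_def 1 2 by (simp_all add: algebra_simps)
qed

lemma sum_transition_upper:
  assumes "0 \<le> j" "j \<le> int n"
  shows "(\<Sum>l = - int n..int n. v l * (if 0 \<le> j \<and> l + j \<in> {0..int n} then b (- (l + j)) else 0))
       = (\<Sum>m\<le>n. b (- int m) * (v (int m - j) :: complex))"
proof -
  have "(\<Sum>l = - int n..int n. v l * (if 0 \<le> j \<and> l + j \<in> {0..int n} then b (- (l + j)) else 0))
      = (\<Sum>l \<in> {- j..int n - j}. v l * b (- (l + j)))"
    using assms by (intro sum.mono_neutral_cong_right) auto
  also have "\<dots> = (\<Sum>m\<le>n. b (- int m) * v (int m - j))"
    by (rule sum.reindex_bij_witness[where i = "\<lambda>m. int m - j" and j = "\<lambda>l. nat (l + j)"]) auto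
  finally show ?thesis .
qed

lemma sum_transition_lower:
  assumes "j \<le> 0" "- int n \<le> j"
  shows "(\<Sum>l = - int n..int n. v l * (if j \<le> 0 \<and> l + j \<in> {- int n..0} then b (- (l + j)) else 0))
       = (\<Sum>m\<le>n. b (int m) * (v (- j - int m) :: complex))"
proof -
  have "(\<Sum>l = - int n..int n. v l * (if j \<le> 0 \<and> l + j \<in> {- int n..0} then b (- (l + j)) else 0))
      = (\<Sum>l \<in> {- int n - j.. - j}. v l * b (- (l + j)))"
    using assms by (intro sum.mono_neutral_cong_right) auto
  also have "\<dots> = (\<Sum>m\<le>n. b (int m) * v (- j - int m))"
    by (rule sum.reindex_bij_witness[where i = "\<lambda>m. - j - int m" and j = "\<lambda>l. nat (- (l + j))"])
      auto
  finally show ?thesis .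
qed

text \<open>
  One row of the factorisation of the Jacobian matrix. The real variable $a_0$ is moved in the
  direction \<open>u = 1\<close> only, where the linear and the conjugate linear part of the differential both count.
\<close>

lemma coeff_deriv_gen_moment:
  assumes a0: "a 0 \<in> \<real>"
    and q: "\<And>z. cmod z = 1 \<Longrightarrow> eval2 q (f_poly n a z) (f_star n a z) \<noteq> 0"
    and j: "j \<in> {- int n..int n}"
  shows "coeff_deriv j (gen_moment n (ratfun2 p q)) a =
     (\<Sum>l = - int n..int n. residue_entry n (ratfun2 p q) a l * transition n (deriv_coeff a) l j)"
proof -
  let ?v = "residue_entry n (ratfun2 p q) a" and ?b = "deriv_coeff a"
  let ?M = "gen_moment n (ratfun2 p q)"
  define A where "A = (\<lambda>i. \<Sum>m\<le>n. ?b (int m) * ?v (i - int m))"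
  define B where "B = (\<lambda>i. \<Sum>m\<le>n. ?b (- int m) * ?v (int m - i))"
  have D: "((\<lambda>t::real. ?M (a(i := a i + u * of_real t))) has_vector_derivative
      cnj u * A (int i) + u * B (int i)) (at 0)" if "i \<le> n" for i u
    unfolding A_def B_def using gen_moment_directional[OF a0 q that] .
  have W: "wirtinger (\<lambda>w. ?M (a(i := w))) (a i) = B (int i)"
    "wirtinger_cnj (\<lambda>w. ?M (a(i := w))) (a i) = A (int i)" if "i \<le> n" for i
    by (rule wirtinger_eq, rule D[OF that])+
  \<comment> \<open>The derivative in \<open>a 0\<close> is taken at \<open>Re (a 0)\<close>, the directional one at 0: a translation is needed.\<close>
  have "((\<lambda>t::real. ?M (a(0 := of_real t))) has_vector_derivative A 0 + B 0) (at (Re (a 0)))"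
  proof -
    have "((\<lambda>t. t - Re (a 0)) has_vector_derivative 1) (at (Re (a 0)))"
      by (auto intro!: derivative_eq_intros)
    from vector_diff_chain_at[OF this, of "\<lambda>t. ?M (a(0 := a 0 + 1 * of_real t))"] D[of 0 1]
    have "((\<lambda>t::real. ?M (a(0 := a 0 + of_real (t - Re (a 0))))) has_vector_derivative A 0 + B 0)
        (at (Re (a 0)))"
      by (simp add: o_def)
    moreover have "a 0 + of_real (t - Re (a 0)) = of_real t" for t
      using a0 by (auto elim!: Reals_cases)
    ultimately show ?thesis by simp
  qed
  then have Z: "vector_derivative (\<lambda>t::real. ?M (a(0 := of_real t))) (at (Re (a 0))) = A 0 + B 0"
    by (rule vector_derivative_at)
  have "coeff_deriv j ?M a = (if 0 \<le> j then B j else 0) + (if j \<le> 0 then A (- j) else 0)"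
    using j by (auto simp: coeff_deriv_def Z W)
  also have "\<dots> = (\<Sum>l = - int n..int n. ?v l * (if 0 \<le> j \<and> l + j \<in> {0..int n} then ?b (- (l + j)) else 0))
      + (\<Sum>l = - int n..int n. ?v l * (if j \<le> 0 \<and> l + j \<in> {- int n..0} then ?b (- (l + j)) else 0))"
  proof (rule arg_cong2[where f = "(+)"])
    show "(if 0 \<le> j then B j else 0) =
        (\<Sum>l = - int n..int n. ?v l * (if 0 \<le> j \<and> l + j \<in> {0..int n} then ?b (- (l + j)) else 0))"
      using sum_transition_upper[of j n ?v ?b] j by (auto simp: B_def)
    show "(if j \<le> 0 then A (- j) else 0) =
        (\<Sum>l = - int n..int n. ?v l * (if j \<le> 0 \<and> l + j \<in> {- int n..0} then ?b (- (l + j)) else 0))"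
      using sum_transition_lower[of j n ?v ?b] j by (auto simp: A_def)
  qed
  finally show ?thesis
    by (simp only: transition_def distrib_left sum.distrib)
qed

theorem theorem4p1:
  fixes n :: nat
    and P Q :: "int \<Rightarrow> complex poly poly"
    and \<Phi> :: "int \<Rightarrow> complex \<Rightarrow> complex \<Rightarrow> complex"
    and a :: "nat \<Rightarrow> complex"
  assumes "n \<ge> 1"
    and "\<And>k. k \<in> {- int n..int n} \<Longrightarrow> \<Phi> k = ratfun2 (P k) (Q k)"
    and "a 0 \<in> \<real>" and "Re (a 0) > 0"
    and "\<And>k z. k \<in> {- int n..int n} \<Longrightarrow> cmod z = 1 \<Longrightarrow>
           poly (poly (Q k) [:f_star n a z:]) (f_poly n a z) \<noteq> 0"
  shows "moment_jacobian n \<Phi> a =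
    (- 1) ^ n * (2 * a 0 ^ (2 * n + 1) *
      Determinant.det (sym_mat n (\<lambda>k j. residue_entry n (\<Phi> k) a j)) *
      mero_resultant n a)"
proof -
  let ?V = "sym_mat n (\<lambda>k j. residue_entry n (\<Phi> k) a j)"
    and ?T = "sym_mat n (transition n (deriv_coeff a))"
  have "sym_mat n (\<lambda>k j. coeff_deriv j (gen_moment n (\<Phi> k)) a) = ?V * ?T"
    by (rule sym_mat_mult)
      (simp add: assms(2) coeff_deriv_gen_moment assms(3) assms(5)[folded eval2_def])
  then have "moment_jacobian n \<Phi> a = Determinant.det ?V * Determinant.det ?T"
    unfolding moment_jacobian_def
    by (simp add: det_mult[of _ "2 * n + 1"] sym_mat_def)
  moreover have "deriv_coeff a 0 = a 0" "a 0 \<noteq> 0"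
    using assms(4) by (auto simp: deriv_coeff_def)
  ultimately show ?thesis
    by (simp add: det_transition mero_resultant_def)
qed

end
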